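(* Let $r\geq 1$ and $a\geq 2$ be integers. Define $\mathcal{D}=(d_1,d_2,\ldots,d_{3r+2})$ by $d_1=1$, $d_2=2$, $d_k=d_{k-1}+a$ if $k$ is odd and $3\leq k<2r+2$, $d_k=d_{k-1}+1$ if $k$ is even and $3<k\leq 2r+2$, and $d_k=d_{k-1}+a+1$ if $2r+2<k\leq 3r+2$. Then $\mathcal{D}$ has pattern $(+++-\cdots-+)$, i.e., its prefix coin systems of lengths $1,2,3$ are orderly, its prefix coin systems of lengths $4,\ldots,3r+1$ are not orderly, and $\mathcal{D}$ itself is orderly.
   Context: A coin system is a tuple $(c_1,\ldots,c_n)$ of integers with $c_1=1<c_2<\cdots<c_n$; each coin value may be used any number of times. For a positive integer $v$, $opt(v)$ is the minimum number of coins summing to $v$, and $grd(v)$ is the number of coins used by the greedy algorithm (repeatedly take as many coins as possible of the largest coin value not exceeding the remaining amount). A coin system is orderly if $grd(v)=opt(v)$ for all $v>0$. The prefix coin system of length $i$ is $(c_1,\ldots,c_i)$; the pattern of a coin system is the string whose $i$-th symbol is $+$ if the prefix of length $i$ is orderly and $-$ otherwise. *)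

theory Defs
  imports "HOL-Library.Multiset"
begin

(* The tuple (c_1,...,c_n) is a list, so c_i is cs ! (i - 1). Since c_1 = 1 and the entries
   increase, all coin values are positive and natural numbers lose nothing. *)
definition coin_system :: "nat list \<Rightarrow> bool" where
  "coin_system cs \<longleftrightarrow> cs \<noteq> [] \<and> hd cs = 1 \<and> sorted_wrt (<) cs"

(* Only meaningful if v is representable, which always holds when 1 is a coin. *)
definition opt :: "nat list \<Rightarrow> nat \<Rightarrow> nat" where
  "opt cs v = (LEAST m. \<exists>M. set_mset M \<subseteq> set cs \<and> \<Sum>\<^sub># M = v \<and> size M = m)"

(* The set of usable coins is empty only when v = 0, provided 1 is a coin; otherwise (off coin
   systems) the recursion stops with an irrelevant value. *)
function grd :: "nat list \<Rightarrow> nat \<Rightarrow> nat" where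
  "grd cs v =
     (let A = {c \<in> set cs. 0 < c \<and> c \<le> v}
      in if A = {} then 0 else v div Max A + grd cs (v mod Max A))"
  by pat_completeness auto
termination
proof (relation "measure snd", goal_cases)
  case 1
  show ?case by simp
next
  case (2 cs v A)
  have "finite A" using 2 by simp
  then have "Max A \<in> A" using 2 by (intro Max_in)
  then have "0 < Max A" "Max A \<le> v" using 2(1) by blast+
  then have "v mod Max A < v" by (meson mod_less_divisor order_less_le_trans)
  then show ?case by simp
qed

declare grd.simps [simp del]

definition orderly :: "nat list \<Rightarrow> bool" where
  "orderly cs \<longleftrightarrow> (\<forall>v>0. grd cs v = opt cs v)"

definition pattern :: "nat list \<Rightarrow> string" where
  "pattern cs =
     map (\<lambda>i. if orderly (take i cs) then CHR ''+'' else CHR ''-'') [1..<length cs + 1]"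

end

theory Submission
  imports Defs
begin

text \<open>
  Write \<open>b = a + 1\<close>. The coins of \<open>D\<close> are \<open>j b + 1\<close> for \<open>j \<le> r\<close> and \<open>j b + 2\<close> for \<open>j \<le> 2 r\<close>; let \<open>C = 2 r b + 2\<close> be the largest.
  A positive amount below \<open>C\<close> has the form \<open>j b + s\<close>, where \<open>1 \<le> s \<le> b\<close> if \<open>j \<le> r\<close> and
  \<open>2 \<le> s \<le> b + 1\<close> if \<open>j > r\<close>, and there greedy uses \<open>\<lceil>s / 2\<rceil>\<close> coins. Every coin contributes
  at most 2 to the residual \<open>s\<close>, so adding a coin to an amount raises the greedy count by at most
  one; hence greedy is optimal. For the proper prefixes, the amounts \<open>(m + 1) b + 2\<close> (largest coin
  \<open>m b + 2\<close>) and \<open>m b + 4\<close> (largest coin \<open>m b + 1\<close>) are sums of two coins on which greedy spends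
  at least three.
\<close>

section \<open>The greedy algorithm\<close>

lemma grd_0 [simp]: "grd cs 0 = 0"
proof -
  have "{c \<in> set cs. 0 < c \<and> c \<le> 0} = {}" by auto
  then show ?thesis by (subst grd.simps) (simp only: Let_def simp_thms if_True)
qed

lemma grd_Max:
  assumes "m \<in> set cs" "0 < m" "m \<le> v" "\<And>c. c \<in> set cs \<Longrightarrow> c \<le> v \<Longrightarrow> c \<le> m"
  shows "grd cs v = v div m + grd cs (v mod m)"
proof -
  let ?A = "{c \<in> set cs. 0 < c \<and> c \<le> v}"
  have "Max ?A = m" using assms by (intro Max_eqI) auto
  moreover have "?A \<noteq> {}" using assms by blast
  ultimately show ?thesis by (subst grd.simps) (simp only: Let_def if_False)
qed

text \<open>\<open>grd\<close> takes all copies of a coin at once; the inductions below need single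
  coins. If \<open>m\<close> still fits into \<open>v - m\<close>, it stays the largest usable coin
  and its quotient drops by one; otherwise the quotient is 1.\<close>

lemma grd_step:
  assumes "m \<in> set cs" "0 < m" "m \<le> v" "\<And>c. c \<in> set cs \<Longrightarrow> c \<le> v \<Longrightarrow> c \<le> m"
  shows "grd cs v = Suc (grd cs (v - m))"
proof (cases "m \<le> v - m")
  case True
  have "grd cs (v - m) = (v - m) div m + grd cs ((v - m) mod m)"
    using assms True by (intro grd_Max) auto
  then show ?thesis
    using grd_Max[OF assms] assms by (simp add: le_div_geq le_mod_geq)
next
  case False
  then show ?thesis
    using grd_Max[OF assms] assms by (simp add: le_div_geq le_mod_geq)
qed

lemma grd_coin:
  assumes "c \<in> set cs" "0 < c"
  shows "grd cs c = 1"
  using grd_step[of c cs c] assms by simp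

lemma largest_coin:
  assumes "1 \<in> set cs" "0 < (v::nat)"
  obtains m where "m \<in> set cs" "0 < m" "m \<le> v" "\<And>c. c \<in> set cs \<Longrightarrow> c \<le> v \<Longrightarrow> c \<le> m"
proof -
  let ?A = "{c \<in> set cs. 0 < c \<and> c \<le> v}"
  have fin: "finite ?A" and ne: "?A \<noteq> {}" using assms by (auto intro!: exI[of _ 1])
  have "Max ?A \<in> ?A" using fin ne by (rule Max_in)
  moreover have "c \<le> Max ?A" if "c \<in> set cs" "c \<le> v" for c
    using that fin by (cases "c = 0") (auto intro: Max_ge)
  ultimately show thesis using that[of "Max ?A"] by blast
qed

lemma grd_pos:
  assumes "1 \<in> set cs" "0 < v"
  shows "0 < grd cs v"
proof -
  obtain m where "m \<in> set cs" "0 < m" "m \<le> v" "\<And>c. c \<in> set cs \<Longrightarrow> c \<le> v \<Longrightarrow> c \<le> m"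
    using assms largest_coin by blast
  then show ?thesis using grd_step[of m cs v] by simp
qed

lemma grd_attained:
  assumes "1 \<in> set cs"
  shows "\<exists>M. set_mset M \<subseteq> set cs \<and> \<Sum>\<^sub># M = v \<and> size M = grd cs v"
proof (induction v rule: less_induct)
  case (less v)
  show ?case
  proof (cases "v = 0")
    case True
    then show ?thesis by (intro exI[of _ "{#}"]) simp
  next
    case False
    then obtain m where m: "m \<in> set cs" "0 < m" "m \<le> v"
      "\<And>c. c \<in> set cs \<Longrightarrow> c \<le> v \<Longrightarrow> c \<le> m"
      using assms largest_coin by blast
    obtain M where "set_mset M \<subseteq> set cs" "\<Sum>\<^sub># M = v - m" "size M = grd cs (v - m)"
      using less[of "v - m"] m by auto
    then show ?thesis
      using m grd_step[OF m] by (intro exI[of _ "add_mset m M"]) auto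
  qed
qed

lemma opt_le:
  assumes "set_mset M \<subseteq> set cs" "\<Sum>\<^sub># M = v"
  shows "opt cs v \<le> size M"
  unfolding opt_def using assms by (intro Least_le) blast

section \<open>Criteria for orderliness\<close>

text \<open>Building any multiset coin by coin, the greedy count grows by at most one per coin, so
  no representation beats it; \<open>grd_attained\<close> shows that greedy itself yields a
  representation.\<close>

lemma orderlyI:
  assumes one: "1 \<in> set cs"
    and step: "\<And>u c. c \<in> set cs \<Longrightarrow> grd cs (u + c) \<le> Suc (grd cs u)"
  shows "orderly cs"
proof -
  have lower: "grd cs (\<Sum>\<^sub># M) \<le> size M" if "set_mset M \<subseteq> set cs" for M
    using that
  proof (induction M)
    case (add c M)
    then show ?case using step[of c "\<Sum>\<^sub># M"] by (simp add: add.commute)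
  qed simp
  have "opt cs v = grd cs v" for v
    unfolding opt_def
  proof (rule Least_equality)
    show "\<exists>M. set_mset M \<subseteq> set cs \<and> \<Sum>\<^sub># M = v \<and> size M = grd cs v"
      by (rule grd_attained[OF one])
  qed (use lower in blast)
  then show ?thesis by (simp add: orderly_def)
qed

text \<open>Above the largest coin \<open>C\<close> the greedy count only shifts, so it suffices to test amounts
  below \<open>C\<close>.\<close>

lemma orderlyI_below_largest:
  assumes one: "1 \<in> set cs"
    and C: "C \<in> set cs" and largest: "\<And>c. c \<in> set cs \<Longrightarrow> c \<le> C"
    and below: "\<And>u c. c \<in> set cs \<Longrightarrow> u + c < C \<Longrightarrow> grd cs (u + c) \<le> Suc (grd cs u)"
    and above: "\<And>u c. c \<in> set cs \<Longrightarrow> c < C \<Longrightarrow> u < C \<Longrightarrow> C \<le> u + c \<Longrightarrow>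
      grd cs (u + c - C) \<le> grd cs u"
  shows "orderly cs"
proof (rule orderlyI[OF one])
  have "0 < C" using largest[OF one] by simp
  then have shift: "grd cs v = Suc (grd cs (v - C))" if "C \<le> v" for v
    using that C largest by (intro grd_step) auto
  fix u c assume c: "c \<in> set cs"
  show "grd cs (u + c) \<le> Suc (grd cs u)"
  proof (induction u rule: less_induct)
    case (less u)
    consider "C \<le> u" | "u + c < C" | "u < C" "C \<le> u + c" "c < C" | "c = C"
      using largest[OF c] by linarith
    then show ?case
    proof cases
      case 1
      then show ?thesis using less[of "u - C"] shift[of u] shift[of "u + c"] \<open>0 < C\<close> by simp
    next
      case 2
      then show ?thesis using below c by blast
    next
      case 3
      then show ?thesis using above[OF c] shift[of "u + c"] by simp
    next
      case 4
      then show ?thesis using shift[of "u + c"] by simp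
    qed
  qed
qed

text \<open>Two coins pay \<open>x + y\<close>. Greedy takes \<open>m\<close>, then
  \<open>n\<close>, and the strict inequality \<open>n < x + y - m\<close> leaves a positive rest,
  so a third coin follows.\<close>

lemma not_orderlyI:
  assumes one: "1 \<in> set cs" and "x \<in> set cs" "y \<in> set cs"
    and m: "m \<in> set cs" "0 < m" "m \<le> x + y"
      "\<And>c. c \<in> set cs \<Longrightarrow> c \<le> x + y \<Longrightarrow> c \<le> m"
    and n: "n \<in> set cs" "0 < n" "n < x + y - m"
      "\<And>c. c \<in> set cs \<Longrightarrow> c \<le> x + y - m \<Longrightarrow> c \<le> n"
  shows "\<not> orderly cs"
proof -
  have "grd cs (x + y) = Suc (Suc (grd cs (x + y - m - n)))"
    using grd_step[OF m] grd_step[OF n(1,2) less_imp_le[OF n(3)] n(4)] by simp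
  moreover have "0 < grd cs (x + y - m - n)" using n by (intro grd_pos[OF one]) simp
  moreover have "opt cs (x + y) \<le> 2" using opt_le[of "{#x, y#}" cs] assms by simp
  moreover have "0 < x + y" using m(2,3) by linarith
  ultimately show ?thesis unfolding orderly_def by fastforce
qed

section \<open>Orderly systems\<close>

text \<open>Because of the gap only the positive coins 1 and 2 are usable up to \<open>b\<close>, so
  greedy takes twos and at most one 1.\<close>

lemma grd_small:
  assumes "1 \<in> set cs" "2 \<in> set cs" and gap: "\<And>c. c \<in> set cs \<Longrightarrow> c \<le> 2 \<or> b < c"
    and "s \<le> b"
  shows "grd cs s = (s + 1) div 2"
  using \<open>s \<le> b\<close>
proof (induction s rule: less_induct)
  case (less s)
  consider "s = 0" | "s = 1" | "2 \<le> s" by linarith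
  then show ?case
  proof cases
    case 3
    have "grd cs s = Suc (grd cs (s - 2))"
      using assms less.prems 3 by (intro grd_step) force+
    also have "grd cs (s - 2) = (s - 2 + 1) div 2" using less 3 by simp
    finally show ?thesis using 3 by presburger
  qed (use assms(1) grd_coin in auto)
qed

lemma orderly_1:
  assumes "set cs = {1}"
  shows "orderly cs"
  using assms by (intro orderlyI_below_largest[of _ 1]) auto

lemma orderly_1_2:
  assumes "set cs = {1, 2}"
  shows "orderly cs"
proof (rule orderlyI_below_largest[of _ 2])
  fix u c assume "c \<in> set cs" "u + c < 2"
  then have "u = 0 \<and> c = 1" using assms by auto
  then show "grd cs (u + c) \<le> Suc (grd cs u)" using grd_coin[of 1 cs] assms by simp
next
  fix u c :: nat assume "c \<in> set cs" "c < 2" "u < 2" "2 \<le> u + c"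
  then have "u + c - 2 = 0" by simp
  then show "grd cs (u + c - 2) \<le> grd cs u" by simp
qed (use assms in auto)

text \<open>Below \<open>Suc b\<close> an added coin is 1 or 2 and raises
  \<open>(s + 1) div 2\<close> by at most one. Adding a coin smaller than \<open>Suc b\<close> and
  then subtracting \<open>Suc b\<close> lowers the amount, and the formula is monotone.\<close>

lemma orderly_1_2_Suc:
  assumes cs: "set cs = {1, 2, Suc b}" and "2 \<le> b"
  shows "orderly cs"
proof -
  have small: "grd cs s = (s + 1) div 2" if "s \<le> b" for s
    using that assms by (intro grd_small) auto
  show ?thesis
  proof (rule orderlyI_below_largest[of _ "Suc b"])
    fix u c assume "c \<in> set cs" "u + c < Suc b"
    moreover from this have "c \<le> 2" using cs by auto
    ultimately show "grd cs (u + c) \<le> Suc (grd cs u)" using small by simp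
  next
    fix u c assume "c \<in> set cs" "c < Suc b" "u < Suc b" "Suc b \<le> u + c"
    then show "grd cs (u + c - Suc b) \<le> grd cs u" using small by (simp add: div_le_mono)
  qed (use assms in auto)
qed

section \<open>The full system: residuals 1 and 2 above multiples of \<open>b\<close>\<close>

context
  fixes cs :: "nat list" and b r :: nat
  assumes cs: "set cs = (\<lambda>j. 1 + j * b) ` {..r} \<union> (\<lambda>j. 2 + j * b) ` {..2 * r}"
    and b: "3 \<le> b" and r: "1 \<le> r"
begin

lemma coin_cases:
  assumes "c \<in> set cs"
  obtains i e where "c = i * b + e" "e = 1 \<and> i \<le> r \<or> e = 2 \<and> i \<le> 2 * r"
proof -
  consider j where "c = 1 + j * b" "j \<le> r" | j where "c = 2 + j * b" "j \<le> 2 * r"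
    using assms unfolding cs by blast
  then show thesis
  proof cases
    case (1 j)
    then show thesis using that[of j 1] by simp
  next
    case (2 j)
    then show thesis using that[of j 2] by simp
  qed
qed

text \<open>For \<open>s = 1\<close> the amount is a coin. Otherwise greedy takes
  \<open>2 + j * b\<close>, and the rest \<open>s - 2\<close> is below \<open>b\<close>. The window
  for \<open>s\<close> moves up by one at \<open>j = r\<close> because
  \<open>1 + (j + 1) * b\<close> is a coin only for \<open>j < r\<close>.\<close>

lemma grd_residual:
  assumes "1 \<le> s" "s \<le> b \<and> j \<le> r \<or> 2 \<le> s \<and> s \<le> b + 1 \<and> r \<le> j \<and> j < 2 * r"
  shows "grd cs (j * b + s) = (s + 1) div 2"
proof (cases "s = 1")
  case True
  then have "j * b + s \<in> set cs" using assms unfolding cs by auto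
  then show ?thesis using grd_coin True by simp
next
  case False
  have small: "grd cs t = (t + 1) div 2" if "t \<le> b" for t
  proof (rule grd_small[OF _ _ _ that])
    show "1 \<in> set cs" "2 \<in> set cs" unfolding cs by (auto simp: image_iff intro: bexI[of _ 0])
    fix c assume "c \<in> set cs"
    then obtain i e where "c = i * b + e" "e = 1 \<and> i \<le> r \<or> e = 2 \<and> i \<le> 2 * r"
      by (rule coin_cases)
    then show "c \<le> 2 \<or> b < c" by (cases i) auto
  qed
  have "grd cs (j * b + s) = Suc (grd cs (j * b + s - (2 + j * b)))"
  proof (rule grd_step)
    show "2 + j * b \<in> set cs" using assms unfolding cs by auto
    fix c assume c: "c \<in> set cs" and le: "c \<le> j * b + s"
    obtain i e where ie: "c = i * b + e" "e = 1 \<and> i \<le> r \<or> e = 2 \<and> i \<le> 2 * r"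
      using c by (rule coin_cases)
    \<comment> \<open>A coin with \<open>i > j\<close> would force \<open>b + e \<le> s\<close>,
      hence \<open>s = b + 1\<close>, \<open>e = 1\<close> and \<open>r \<le> j < i\<close>, but
      coins of residual 1 have \<open>i \<le> r\<close>.\<close>
    have "i \<le> j"
    proof (rule ccontr)
      assume "\<not> i \<le> j"
      then have "(j + 1) * b \<le> i * b" by (intro mult_le_mono1) simp
      then have "b + e \<le> s" using le ie by simp
      then show False using assms ie \<open>\<not> i \<le> j\<close> by auto
    qed
    then have "i * b \<le> j * b" by simp
    moreover have "e \<le> 2" using ie by auto
    ultimately show "c \<le> 2 + j * b" using ie(1) by linarith
  qed (use False assms in auto)
  also have "j * b + s - (2 + j * b) = s - 2" by simp
  also have "grd cs (s - 2) = (s - 2 + 1) div 2" using assms b by (intro small) auto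
  finally show ?thesis using False assms by presburger
qed

text \<open>Adding a coin may push the residual out of its window. Carrying \<open>b\<close> into
  the multiple restores it and only lowers the residual, so the formula survives as an upper
  bound.\<close>

lemma grd_residual_le:
  assumes "1 \<le> s" "j \<le> r \<or> 2 \<le> s" "j * b + s < 2 + 2 * r * b"
  shows "grd cs (j * b + s) \<le> (s + 1) div 2"
  using assms
proof (induction s arbitrary: j rule: less_induct)
  case (less s)
  have j: "j < 2 * r"
  proof (rule ccontr)
    assume "\<not> j < 2 * r"
    then have "2 * r * b \<le> j * b" by (intro mult_le_mono1) simp
    moreover have "2 \<le> s" using \<open>\<not> j < 2 * r\<close> less.prems(2) r by auto
    ultimately show False using less.prems(3) by linarith
  qed
  have carry: "j * b + s = (j + 1) * b + (s - b)" if "b \<le> s" using that by simp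
  \<comment> \<open>The residual \<open>b + 1\<close> needs care, since carrying it leaves 1: for
    \<open>j < r\<close> this gives a coin, and for \<open>r \<le> j\<close> the residual is still
    inside the window.\<close>
  consider "s \<le> b \<or> s = b + 1 \<and> r \<le> j" | "s = b + 1" "j < r" | "b + 2 \<le> s" by linarith
  then show ?case
  proof cases
    case 1
    then show ?thesis using less.prems j b by (subst grd_residual) auto
  next
    case 2
    then have "grd cs (j * b + s) = 1"
      using carry grd_residual[of 1 "j + 1"] b by (simp add: add.commute)
    then show ?thesis using 2 by simp
  next
    case 3
    then have eq: "j * b + s = (j + 1) * b + (s - b)" by (intro carry) simp
    have "grd cs ((j + 1) * b + (s - b)) \<le> (s - b + 1) div 2"
    proof (rule less.IH)
      show "(j + 1) * b + (s - b) < 2 + 2 * r * b" using less.prems(3) unfolding eq .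
    qed (use 3 b in auto)
    also have "\<dots> \<le> (s + 1) div 2" by (intro div_le_mono) simp
    finally show ?thesis unfolding eq .
  qed
qed

lemma residual_exists:
  assumes "0 < w" "w < 2 + 2 * r * b"
  obtains j s where "w = j * b + s" "1 \<le> s"
    "s \<le> b \<and> j \<le> r \<or> 2 \<le> s \<and> s \<le> b + 1 \<and> r \<le> j \<and> j < 2 * r"
proof -
  \<comment> \<open>Dividing \<open>w - 1\<close> instead of \<open>w\<close> puts the residual into
    the range from 1 to \<open>b\<close>.\<close>
  define j where "j = (w - 1) div b"
  define s where "s = (w - 1) mod b + 1"
  have w: "w = j * b + s" using assms by (simp add: j_def s_def)
  have s: "1 \<le> s" "s \<le> b" using b by (simp_all add: s_def Suc_le_eq)
  have j: "j < 2 * r \<or> j = 2 * r \<and> s = 1"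
  proof (rule ccontr)
    assume *: "\<not> ?thesis"
    then have "2 * r * b \<le> j * b" by (intro mult_le_mono1) auto
    moreover have "(2 * r + 1) * b \<le> j * b" if "j > 2 * r" using that by (intro mult_le_mono1) auto
    ultimately show False using w assms * s b by (cases "j > 2 * r") auto
  qed
  show thesis
  proof (cases "j \<le> r \<or> 2 \<le> s")
    case True
    then have "s \<le> b \<and> j \<le> r \<or> 2 \<le> s \<and> s \<le> b + 1 \<and> r \<le> j \<and> j < 2 * r"
      using s j by auto
    then show thesis by (rule that[OF w s(1)])
  next
    \<comment> \<open>Here the residual is 1 above a multiple beyond \<open>r\<close>; borrowing one
      \<open>b\<close> back turns it into \<open>b + 1\<close>.\<close>
    case False
    then have "w = (j - 1) * b + (b + 1)" using w s by (cases j) auto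
    moreover have "r \<le> j - 1" "j - 1 < 2 * r" using False j r by auto
    ultimately show thesis using that[of "j - 1" "b + 1"] b by simp
  qed
qed

lemma orderly_two_residues: "orderly cs"
proof (rule orderlyI_below_largest[of _ "2 + 2 * r * b"])
  show "1 \<in> set cs" "2 + 2 * r * b \<in> set cs" unfolding cs by (auto simp: image_iff intro: bexI[of _ 0])
  show "c \<le> 2 + 2 * r * b" if c: "c \<in> set cs" for c
  proof -
    obtain i e where ie: "c = i * b + e" "e = 1 \<and> i \<le> r \<or> e = 2 \<and> i \<le> 2 * r"
      using c by (rule coin_cases)
    then have "i * b \<le> 2 * r * b" by (intro mult_le_mono1) auto
    moreover have "e \<le> 2" using ie by auto
    ultimately show ?thesis using ie(1) by linarith
  qed
next
  fix u c assume c: "c \<in> set cs" and less: "u + c < 2 + 2 * r * b"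
  obtain i e where ie: "c = i * b + e" "e = 1 \<and> i \<le> r \<or> e = 2 \<and> i \<le> 2 * r"
    using c by (rule coin_cases)
  show "grd cs (u + c) \<le> Suc (grd cs u)"
  proof (cases "u = 0")
    case True
    then show ?thesis using grd_coin[OF c] ie by auto
  next
    case False
    then obtain j s where js: "u = j * b + s" "1 \<le> s"
      "s \<le> b \<and> j \<le> r \<or> 2 \<le> s \<and> s \<le> b + 1 \<and> r \<le> j \<and> j < 2 * r"
      using residual_exists[of u] less by auto
    have eq: "u + c = (j + i) * b + (s + e)" using js ie by (simp add: algebra_simps)
    have "grd cs (u + c) \<le> (s + e + 1) div 2"
      unfolding eq
    proof (rule grd_residual_le)
      show "(j + i) * b + (s + e) < 2 + 2 * r * b" using less unfolding eq .
    qed (use js ie in auto)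
    also have "\<dots> \<le> Suc ((s + 1) div 2)" using ie by auto
    finally show ?thesis using grd_residual[OF js(2,3)] js by simp
  qed
next
  fix u c assume c: "c \<in> set cs" "c < 2 + 2 * r * b" and u: "u < 2 + 2 * r * b"
    and ge: "2 + 2 * r * b \<le> u + c"
  obtain i e where ie: "c = i * b + e" "e = 1 \<and> i \<le> r \<or> e = 2 \<and> i \<le> 2 * r"
    using c(1) by (rule coin_cases)
  obtain j s where js: "u = j * b + s" "1 \<le> s"
    "s \<le> b \<and> j \<le> r \<or> 2 \<le> s \<and> s \<le> b + 1 \<and> r \<le> j \<and> j < 2 * r"
    using residual_exists[of u] u c ge by auto
  have gu: "grd cs u = (s + 1) div 2" using grd_residual[OF js(2,3)] js by simp
  have sum: "u + c = (j + i) * b + (s + e)" using js ie by (simp add: algebra_simps)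
  show "grd cs (u + c - (2 + 2 * r * b)) \<le> grd cs u"
  \<comment> \<open>The largest coin has multiple \<open>2 * r\<close> and residual 2. If the
    multiples suffice, subtracting it removes at least as much residual as \<open>c\<close>
    added.\<close>
  proof (cases "2 * r \<le> j + i")
    case True
    then obtain k where k: "j + i = 2 * r + k" using le_Suc_ex by blast
    have eq: "u + c - (2 + 2 * r * b) = k * b + (s + e - 2)"
    proof -
      have "u + c = 2 * r * b + k * b + (s + e)" unfolding sum k by (simp add: add_mult_distrib)
      moreover have "2 \<le> s + e" using js ie by linarith
      ultimately show ?thesis by linarith
    qed
    consider "s = 1" "e = 1" | "1 \<le> s + e - 2" using js ie by linarith
    then show ?thesis
    proof cases
      case 1
      \<comment> \<open>Two residuals 1 force \<open>i\<close> and \<open>j\<close> to be at most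
        \<open>r\<close>, so \<open>u + c\<close> is exactly the largest coin and nothing
        remains.\<close>
      then have "k = 0" using js ie k by auto
      then show ?thesis unfolding eq using 1 by simp
    next
      case 2
      have "grd cs (u + c - (2 + 2 * r * b)) \<le> (s + e - 2 + 1) div 2"
        unfolding eq
      proof (rule grd_residual_le)
        \<comment> \<open>If the new residual is 1, then one of \<open>s\<close>, \<open>e\<close>
          is 1 and its multiple is at most \<open>r\<close>; the other multiple is at most
          \<open>2 * r\<close>, so \<open>k \<le> r\<close>.\<close>
        show "k \<le> r \<or> 2 \<le> s + e - 2" using js ie k by auto
        show "k * b + (s + e - 2) < 2 + 2 * r * b" using eq u c ge by linarith
      qed (use 2 in simp)
      also have "\<dots> \<le> (s + 1) div 2" using ie by (intro div_le_mono) auto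
      finally show ?thesis using gu by simp
    qed
  next
    \<comment> \<open>The largest coin is reached only through a carry out of \<open>s + e\<close>.
      As \<open>s \<le> b + 1\<close> and \<open>e \<le> 2\<close>, at most 1 is left over.\<close>
    case False
    then obtain k where k: "2 * r = j + i + Suc k" using less_imp_Suc_add[of "j + i" "2 * r"] by auto
    then have "u + c - (2 + 2 * r * b) \<le> s + e - 2 - b"
    proof -
      have "2 * r * b = (j + i) * b + b + k * b" unfolding k by (simp add: add_mult_distrib)
      then show ?thesis using sum by linarith
    qed
    also have "\<dots> \<le> 1" using js ie by auto
    finally have "u + c - (2 + 2 * r * b) = 0 \<or> u + c - (2 + 2 * r * b) = 1" by linarith
    moreover have "grd cs 1 = 1" using grd_residual[of 1 0] b by simp
    ultimately show ?thesis using gu js by auto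
  qed
qed

end

section \<open>Systems that are not orderly\<close>

text \<open>Two coins of residual 1 sum to \<open>(m + 1) * b + 2\<close>. Greedy takes
  \<open>2 + m * b\<close>, is left with \<open>b\<close>, and after a 2 still has
  \<open>b - 2 > 0\<close> to pay. The \<open>min\<close> covers prefixes on both sides of length
  \<open>2 * r + 2\<close>.\<close>

lemma not_orderly_top_2:
  assumes cs: "set cs = (\<lambda>j. 1 + j * b) ` {..min r m} \<union> (\<lambda>j. 2 + j * b) ` {..m}"
    and b: "3 \<le> b" and m: "1 \<le> m" "m < 2 * r"
  shows "\<not> orderly cs"
proof -
  \<comment> \<open>With the largest available multiple \<open>i\<close>, the partner
    \<open>m + 1 - i\<close> is at most \<open>i\<close>; for \<open>m > r\<close> this is where
    \<open>m < 2 * r\<close> enters.\<close>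
  define i where "i = min r m"
  have i: "1 \<le> i" "i \<le> r" "i \<le> m" "m + 1 - i \<le> i" using m by (auto simp: i_def)
  have "1 + i * b + (1 + (m + 1 - i) * b) = 2 + (i + (m + 1 - i)) * b"
    by (simp only: add_mult_distrib)
  then have v: "1 + i * b + (1 + (m + 1 - i) * b) = 2 + m * b + b" using i by simp
  have cases: "c \<le> 2 \<or> b < c" "c \<le> 2 + m * b" if c: "c \<in> set cs" for c
  proof -
    obtain j e where je: "c = j * b + e" "j \<le> m" "e = 1 \<or> e = 2"
    proof -
      consider j where "c = 1 + j * b" "j \<le> m" | j where "c = 2 + j * b" "j \<le> m"
        using c unfolding cs by fastforce
      then show thesis
        by cases (use that add.commute in metis)+
    qed
    show "c \<le> 2 \<or> b < c" using je by (cases j) auto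
    have "j * b \<le> m * b" "e \<le> 2" using je by auto
    then show "c \<le> 2 + m * b" using je(1) by linarith
  qed
  show ?thesis
  proof (rule not_orderlyI[of _ "1 + i * b" "1 + (m + 1 - i) * b" "2 + m * b" 2])
    show "1 \<in> set cs" "2 \<in> set cs" unfolding cs by (auto simp: image_iff intro: bexI[of _ 0])
    show "1 + i * b \<in> set cs" "1 + (m + 1 - i) * b \<in> set cs" "2 + m * b \<in> set cs"
      unfolding cs i_def[symmetric] using i by blast+
    show "c \<le> 2 + m * b" if "c \<in> set cs" for c using that by (rule cases(2))
    show "c \<le> 2" if "c \<in> set cs" "c \<le> 1 + i * b + (1 + (m + 1 - i) * b) - (2 + m * b)" for c
      using cases(1)[OF that(1)] that(2) unfolding v by auto
  qed (use b in \<open>unfold v, simp_all\<close>)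
qed

text \<open>Two coins of residual 2 sum to \<open>m * b + 4\<close>. Greedy is lured by
  \<open>1 + m * b\<close> and must pay the remaining 3 as 2 and 1. For \<open>m \<ge> 2\<close> the
  coin \<open>2 + b\<close> is present.\<close>

lemma not_orderly_top_1:
  assumes cs: "set cs = (\<lambda>j. 1 + j * b) ` {..m} \<union> (\<lambda>j. 2 + j * b) ` {..<m}"
    and b: "3 \<le> b" and m: "2 \<le> m"
  shows "\<not> orderly cs"
proof -
  have v: "2 + (m - 1) * b + (2 + b) = 1 + m * b + 3" using m by (cases m) auto
  have cases: "c \<le> 2 \<or> b < c" "c \<le> 1 + m * b" if c: "c \<in> set cs" for c
  proof -
    obtain j e where je: "c = j * b + e" "j \<le> m" "e = 1 \<or> e = 2 \<and> j < m"
    proof -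
      consider j where "c = 1 + j * b" "j \<le> m" | j where "c = 2 + j * b" "j < m"
        using c unfolding cs by blast
      then show thesis
        by cases (use that add.commute less_imp_le in metis)+
    qed
    show "c \<le> 2 \<or> b < c" using je by (cases j) auto
    show "c \<le> 1 + m * b"
    proof (cases "j < m")
      case True
      then have "(j + 1) * b \<le> m * b" by (intro mult_le_mono1) simp
      moreover have "e \<le> 2" using je by auto
      ultimately show ?thesis using je(1) b by simp
    next
      case False
      then show ?thesis using je by auto
    qed
  qed
  show ?thesis
  proof (rule not_orderlyI[of _ "2 + (m - 1) * b" "2 + b" "1 + m * b" 2])
    show "1 \<in> set cs" "2 \<in> set cs" "2 + b \<in> set cs"
      unfolding cs using m by (auto simp: image_iff intro: bexI[of _ 0] bexI[of _ 1])
    show "2 + (m - 1) * b \<in> set cs" "1 + m * b \<in> set cs"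
      unfolding cs using m by auto
    show "c \<le> 1 + m * b" if "c \<in> set cs" for c using that by (rule cases(2))
    show "c \<le> 2" if "c \<in> set cs" "c \<le> 2 + (m - 1) * b + (2 + b) - (1 + m * b)" for c
      using cases(1)[OF that(1)] that(2) b unfolding v by auto
  qed (unfold v, simp_all)
qed

section \<open>Coin sets of the prefixes and the resulting pattern\<close>

theorem theorem4p3:
  fixes r a :: nat and d :: "nat \<Rightarrow> nat" and D :: "nat list"
  assumes "r \<ge> 1" and "a \<ge> 2"
    and "d 1 = 1" and "d 2 = 2"
    and "\<And>k. odd k \<Longrightarrow> 3 \<le> k \<Longrightarrow> k < 2 * r + 2 \<Longrightarrow> d k = d (k - 1) + a"
    and "\<And>k. even k \<Longrightarrow> 3 < k \<Longrightarrow> k \<le> 2 * r + 2 \<Longrightarrow> d k = d (k - 1) + 1"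
    and "\<And>k. 2 * r + 2 < k \<Longrightarrow> k \<le> 3 * r + 2 \<Longrightarrow> d k = d (k - 1) + a + 1"
    and "D = map d [1..<3 * r + 3]"
  shows "coin_system D \<and>
    pattern D = ''+++'' @ replicate (3 * r - 2) (CHR ''-'') @ ''+''"
proof
  define b where "b = a + 1"
  have b: "3 \<le> b" using assms(2) by (simp add: b_def)
  have low: "d (2 * j + 1) = 1 + j * b \<and> d (2 * j + 2) = 2 + j * b" if "j \<le> r" for j
    using that
  proof (induction j)
    case 0
    then show ?case using assms(3,4) by (simp add: numeral_2_eq_2)
  next
    case (Suc j)
    have "d (2 * j + 3) = d (2 * j + 2) + a" using assms(5)[of "2 * j + 3"] Suc.prems by simp
    moreover have "d (2 * j + 4) = d (2 * j + 3) + 1"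
    proof -
      have "2 * j + 4 - 1 = 2 * j + 3" by simp
      then show ?thesis using assms(6)[of "2 * j + 4"] Suc.prems by (simp add: add.commute)
    qed
    ultimately show ?case using Suc by (simp add: b_def numeral_eq_Suc)
  qed
  \<comment> \<open>Past index \<open>2 * r + 2\<close> each step is a full \<open>b\<close>, so the
    residual stays 2.\<close>
  have high: "d (2 * r + 2 + t) = 2 + (r + t) * b" if "t \<le> r" for t
    using that
  proof (induction t)
    case 0
    then show ?case using low[of r] by simp
  next
    case (Suc t)
    then show ?case using assms(7)[of "2 * r + 2 + Suc t"] by (simp add: b_def)
  qed
  have even_set: "d ` {1..2 * m} = (\<lambda>j. 1 + j * b) ` {..<m} \<union> (\<lambda>j. 2 + j * b) ` {..<m}"
    if "m \<le> Suc r" for m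
    using that
  proof (induction m)
    case (Suc m)
    have "{1..2 * Suc m} = insert (2 * m + 2) (insert (2 * m + 1) {1..2 * m})" by auto
    then have "d ` {1..2 * Suc m} = insert (d (2 * m + 2)) (insert (d (2 * m + 1)) (d ` {1..2 * m}))"
      by (simp only: image_insert)
    then show ?case using low[of m] Suc by (auto simp: lessThan_Suc)
  qed simp
  have odd_set: "d ` {1..2 * m + 1} = (\<lambda>j. 1 + j * b) ` {..m} \<union> (\<lambda>j. 2 + j * b) ` {..<m}"
    if "m \<le> r" for m
  proof -
    have "d ` {1..2 * m + 1} = insert (d (2 * m + 1)) (d ` {1..2 * m})"
      by (simp add: atLeastAtMostSuc_conv)
    then show ?thesis using low[of m] even_set[of m] that
      by (auto simp: lessThan_Suc_atMost[symmetric] lessThan_Suc)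
  qed
  have high_set: "d ` {1..2 * r + 2 + t} = (\<lambda>j. 1 + j * b) ` {..r} \<union> (\<lambda>j. 2 + j * b) ` {..r + t}"
    if "t \<le> r" for t
    using that
  proof (induction t)
    case 0
    then show ?case using even_set[of "Suc r"] by (simp add: lessThan_Suc_atMost)
  next
    case (Suc t)
    have "d ` {1..2 * r + 2 + Suc t} = insert (d (2 * r + 2 + Suc t)) (d ` {1..2 * r + 2 + t})"
      by (simp add: atLeastAtMostSuc_conv)
    then show ?case using high[OF Suc.prems] Suc by (auto simp: atMost_Suc)
  qed

  have len: "length D = 3 * r + 2" using assms(8) by simp
  have prefix: "set (take k D) = d ` {1..k}" if "k \<le> 3 * r + 2" for k
  proof -
    have "take k D = map d [1..<k + 1]" using that unfolding assms(8) by (simp add: take_map take_upt)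
    then show ?thesis by (simp add: atLeastLessThanSuc_atLeastAtMost del: upt_Suc)
  qed

  have inc: "d k < d (Suc k)" if "1 \<le> k" "k < 3 * r + 2" for k
  proof -
    consider "k = 1" | "odd (Suc k)" "Suc k < 2 * r + 2" "k \<noteq> 1"
      | "even (Suc k)" "Suc k \<le> 2 * r + 2" "k \<noteq> 1" | "2 * r + 2 < Suc k" by fastforce
    then show ?thesis
    proof cases
      case 1
      then show ?thesis using assms(3,4) by (simp add: numeral_2_eq_2)
    next
      case 2
      then show ?thesis using assms(5)[of "Suc k"] assms(2) that by simp
    next
      case 3
      then have "3 < Suc k" using that by (cases "k = 2") auto
      then show ?thesis using assms(6)[of "Suc k"] 3 by simp
    next
      case 4
      then show ?thesis using assms(7)[of "Suc k"] that by simp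
    qed
  qed
  have "sorted_wrt (<) D"
    unfolding sorted_wrt_iff_nth_Suc_transp[OF transp_on_less] len
    using inc by (simp add: assms(8) del: upt_Suc)
  then show "coin_system D"
    using assms(1,3) by (simp add: coin_system_def assms(8) hd_map del: upt_Suc)

  have plus: "orderly (take k D)" if k: "k \<in> {1, 2, 3, 3 * r + 2}" for k
  proof -
    consider "k = 1" | "k = 2" | "k = 3" | "k = 3 * r + 2" using k by blast
    then show ?thesis
    proof cases
      case 1
      then show ?thesis using prefix[of 1] assms(3) by (intro orderly_1) simp
    next
      case 2
      have "{1..2} = {1, 2::nat}" by auto
      then show ?thesis using 2 prefix[of 2] assms(3,4) by (intro orderly_1_2) simp
    next
      case 3
      have "{1..3} = {1, 2, 3::nat}" by auto
      moreover have "d 3 = Suc b" using low[of 1] assms(1) by (simp add: numeral_3_eq_3)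
      ultimately show ?thesis
        using 3 prefix[of 3] assms(1,3,4) b by (intro orderly_1_2_Suc[of _ b]) auto
    next
      case 4
      \<comment> \<open>The full length corresponds to \<open>t = r\<close> in
        \<open>high_set\<close>, which extends the multiples of residual 2 to
        \<open>2 * r\<close>.\<close>
      have k': "k = 2 * r + 2 + r" "r + r = 2 * r" using 4 by auto
      have "set (take k D) = d ` {1..k}" using 4 by (intro prefix) simp
      then have "set (take k D) = (\<lambda>j. 1 + j * b) ` {..r} \<union> (\<lambda>j. 2 + j * b) ` {..2 * r}"
        using high_set[OF le_refl] unfolding k' by (rule trans)
      then show ?thesis using b assms(1) by (rule orderly_two_residues)
    qed
  qed
  have minus: "\<not> orderly (take k D)" if k: "4 \<le> k" "k < 3 * r + 2" for k
  proof -
    \<comment> \<open>The largest coin is \<open>1 + m * b\<close>, \<open>2 + (m - 1) * b\<close>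
      or \<open>2 + (r + t) * b\<close>, respectively; length \<open>2 * r + 2\<close> falls under
      the last case with \<open>t = 0\<close>.\<close>
    consider m where "k = 2 * m + 1" "m \<le> r" | m where "k = 2 * m" "m \<le> r"
      | t where "k = 2 * r + 2 + t"
    proof (cases "k \<le> 2 * r + 1")
      case True
      then show thesis using that(1,2) by (cases "even k") (auto elim!: evenE oddE)
    next
      case False
      then show thesis using that(3)[of "k - (2 * r + 2)"] by simp
    qed
    then show ?thesis
    proof cases
      case (1 m)
      then show ?thesis
        using k prefix[of k] odd_set[of m] b by (intro not_orderly_top_1[of _ b m]) auto
    next
      case (2 m)
      then obtain n where n: "m = Suc n" using k by (cases m) auto
      have "set (take k D) = (\<lambda>j. 1 + j * b) ` {..min r n} \<union> (\<lambda>j. 2 + j * b) ` {..n}"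
        using 2 n k prefix[of k] even_set[of m] by (simp add: lessThan_Suc_atMost min_def)
      then show ?thesis using b by (rule not_orderly_top_2) (use 2 n k in auto)
    next
      case (3 t)
      have "set (take k D) = (\<lambda>j. 1 + j * b) ` {..min r (r + t)} \<union> (\<lambda>j. 2 + j * b) ` {..r + t}"
        using 3 k prefix[of k] high_set[of t] by simp
      then show ?thesis using b by (rule not_orderly_top_2) (use 3 k assms(1) in auto)
    qed
  qed

  let ?f = "\<lambda>i. if orderly (take i D) then CHR ''+'' else CHR ''-''"
  have split: "[1..<length D + 1] = [1, 2, 3] @ [4..<3 * r + 2] @ [3 * r + 2]"
  proof -
    have "[1..<Suc (3 * r + 2)] = [1..<3 * r + 2] @ [3 * r + 2]" by (intro upt_Suc_append) simp
    \<comment> \<open>The natural subtraction in \<open>3 * r - 2\<close> is exact because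
      \<open>r \<ge> 1\<close>, so \<open>4 + (3 * r - 2)\<close> is the end index
      \<open>3 * r + 2\<close>.\<close>
    moreover have "[1..<4 + (3 * r - 2)] = [1..<4] @ [4..<4 + (3 * r - 2)]"
      by (intro upt_add_eq_append) simp
    moreover have "length D + 1 = Suc (3 * r + 2)" "4 + (3 * r - 2) = 3 * r + 2"
      using len assms(1) by simp_all
    moreover have "[1..<4] = [1, 2, 3]" by (simp add: upt_rec)
    ultimately show ?thesis by (simp only: append_assoc)
  qed
  have mid: "map ?f [4..<3 * r + 2] = replicate (3 * r - 2) (CHR ''-'')"
    using minus by (intro replicate_eqI) (auto simp del: upt_Suc)
  show "pattern D = ''+++'' @ replicate (3 * r - 2) (CHR ''-'') @ ''+''"
    unfolding pattern_def split map_append mid using plus by simp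
qed

end
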